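(* Let $f:\operatorname{dom}(f)\subseteq\mathbb{R}^n\to\mathbb{R}$ be $\mathcal{C}^3$ on the open ball $B(x^0,\overline{\Delta})$ with $f(x^0)\neq0$, and denote by $L$ the Lipschitz constant of $\nabla^2 f$ on $B(x^0,\overline{\Delta})$. Let $\mathcal{X}=\langle x^0,x^1,\ldots,x^m\rangle$ be an ordered set of distinct points with radius $\Delta<\overline{\Delta}$ such that $S=S(\mathcal{X})$ has full rank. Let $\mathbb{U}=\operatorname{span}S$, $\widehat{S}=S/\Delta$ and $a>0$. Then $$\|\nabla^{cc}\log_a f(\mathcal{X})-\nabla\log_a f_{\mathbb{U}}(x^0)\|\le\left|\frac{1}{f(x^0)\ln a}\right|\frac{L\sqrt{m}}{6}\,\big\|(\widehat{S}^\top)^\dagger\big\|\Delta^2.$$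
   Context: Vectors carry the Euclidean norm and matrices the induced operator norm; $A^\dagger$ is the Moore--Penrose pseudoinverse. For $\mathcal{X}=\langle x^0,x^1,\ldots,x^m\rangle\subset\mathbb{R}^n$ write $x^i=x^0+d^i$; the radius is $\Delta=\max_{i\in\{1,\ldots,m\}}\|d^i\|$ and $S(\mathcal{X})=[d^1\ \cdots\ d^m]\in\mathbb{R}^{n\times m}$. Full rank means $\operatorname{rank}S=\min\{m,n\}$; $\operatorname{span}S$ is the column span. The generalized centred simplex gradient of $f$ over $\mathcal{X}$ is $\nabla^c f(\mathcal{X})=(S^\top)^\dagger\delta^c_f(\mathcal{X})$, where $\delta^c_f(\mathcal{X})\in\mathbb{R}^m$ has $i$-th entry $\tfrac12\big(f(x^0+d^i)-f(x^0-d^i)\big)$. For $f(x^0)\neq0$ and $a\in(0,\infty)$, the generalized centred simplex calculus gradient of $\log_a f$ over $\mathcal{X}$ is defined as $\nabla^{cc}\log_a f(\mathcal{X})=\dfrac{1}{f(x^0)\ln a}\nabla^c f(\mathcal{X})$. $f_{\mathbb{U}}(y)=f\big(x^0+\operatorname{Proj}_{\mathbb{U}}(y-x^0)\big)$ with $\operatorname{Proj}_{\mathbb{U}}$ the orthogonal projection onto $\mathbb{U}$, and $\nabla\log_a f_{\mathbb{U}}(x^0)$ denotes the gradient of $\log_a f_{\mathbb{U}}$ at $x^0$. If $S$ has full row rank, then $\mathbb{U}=\mathbb{R}^n$ and $f_{\mathbb{U}}=f$. *)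

theory Defs
  imports "HOL-Analysis.Analysis"
begin

subsection \<open>Matrices\<close>

text \<open>
  The norm of the library on the type of matrices is the Frobenius norm, so the induced operator
  norm has to be taken explicitly.
\<close>

definition opnorm :: "real^'n^'m \<Rightarrow> real" where
  "opnorm A = onorm (\<lambda>v. A *v v)"

definition is_mp_inverse :: "real^'n^'m \<Rightarrow> real^'m^'n \<Rightarrow> bool" where
  "is_mp_inverse A P \<longleftrightarrow>
     A ** P ** A = A \<and> P ** A ** P = P \<and>
     transpose (A ** P) = A ** P \<and> transpose (P ** A) = P ** A"

definition pinv :: "real^'n^'m \<Rightarrow> real^'m^'n" where
  "pinv A = (THE P. is_mp_inverse A P)"

lemma is_mp_inverse_unique:
  assumes P: "is_mp_inverse A P" and Q: "is_mp_inverse A Q"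
  shows "P = Q"
proof -
  have "A ** P = transpose (A ** P)"
    using P by (simp add: is_mp_inverse_def)
  also have "\<dots> = transpose ((A ** Q) ** (A ** P))"
    using Q by (simp add: is_mp_inverse_def matrix_mul_assoc)
  also have "\<dots> = (A ** P) ** (A ** Q)"
    using P Q by (simp add: is_mp_inverse_def matrix_transpose_mul)
  also have "\<dots> = A ** Q"
    using P by (simp add: is_mp_inverse_def matrix_mul_assoc)
  finally have AP: "A ** P = A ** Q" .
  have "P ** A = transpose (P ** A)"
    using P by (simp add: is_mp_inverse_def)
  also have "\<dots> = transpose ((P ** A) ** (Q ** A))"
    using Q by (simp add: is_mp_inverse_def flip: matrix_mul_assoc)
  also have "\<dots> = (Q ** A) ** (P ** A)"
    using P Q by (simp add: is_mp_inverse_def matrix_transpose_mul)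
  also have "\<dots> = Q ** A"
    using P by (simp add: is_mp_inverse_def flip: matrix_mul_assoc)
  finally have PA: "P ** A = Q ** A" .
  have "P = P ** (A ** P)"
    using P by (simp add: is_mp_inverse_def matrix_mul_assoc)
  also have "\<dots> = (Q ** A) ** Q"
    by (simp add: AP PA matrix_mul_assoc)
  also have "\<dots> = Q"
    using Q by (simp add: is_mp_inverse_def)
  finally show ?thesis .
qed

lemma pinv_eqI: "is_mp_inverse A P \<Longrightarrow> pinv A = P"
  unfolding pinv_def by (blast intro: the_equality is_mp_inverse_unique)


subsection \<open>Differential calculus\<close>

definition grad :: "('a::real_inner \<Rightarrow> real) \<Rightarrow> 'a \<Rightarrow> 'a" where
  "grad f x = (THE g. GDERIV f x :> g)"

lemma grad_eqI: "GDERIV f x :> g \<Longrightarrow> grad f x = g"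
  unfolding grad_def
proof (rule the_equality)
  fix h assume "GDERIV f x :> g" "GDERIV f x :> h"
  then have "(\<lambda>v. v \<bullet> h) = (\<lambda>v. v \<bullet> g)"
    unfolding gderiv_def by (metis has_derivative_unique)
  then show "h = g"
    by (metis vector_eq_ldot)
qed

definition hessian :: "(real^'n \<Rightarrow> real) \<Rightarrow> real^'n \<Rightarrow> real^'n^'n" where
  "hessian f x = jacobian (grad f) (at x)"

text \<open>
  Membership in the class $C^k$ on an open set, by recursion over the directional derivatives;
  in finite dimension this is the usual notion.
\<close>

primrec C_k_on :: "nat \<Rightarrow> ('a::euclidean_space \<Rightarrow> real) \<Rightarrow> 'a set \<Rightarrow> bool" where
  "C_k_on 0 f U \<longleftrightarrow> continuous_on U f"
| "C_k_on (Suc k) f U \<longleftrightarrow>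
     (\<forall>x\<in>U. f differentiable (at x)) \<and>
     (\<forall>v. C_k_on k (\<lambda>x. frechet_derivative f (at x) v) U)"


subsection \<open>Orthogonal projection\<close>

definition orth_proj :: "'a::euclidean_space set \<Rightarrow> 'a \<Rightarrow> 'a" where
  "orth_proj U v = (THE p. p \<in> U \<and> (\<forall>u\<in>U. orthogonal (v - p) u))"

lemma orth_proj_eqI:
  assumes U: "subspace U" and p: "p \<in> U" "\<And>u. u \<in> U \<Longrightarrow> orthogonal (v - p) u"
  shows "orth_proj U v = p"
  unfolding orth_proj_def
proof (rule the_equality)
  fix q assume q: "q \<in> U \<and> (\<forall>u\<in>U. orthogonal (v - q) u)"
  have "q - p \<in> U"
    using U p q by (simp add: subspace_diff)
  then have "(v - p) \<bullet> (q - p) = 0" "(v - q) \<bullet> (q - p) = 0"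
    using p q by (auto simp: orthogonal_def)
  then have "(q - p) \<bullet> (q - p) = 0"
    by (simp add: inner_diff_left)
  then show "q = p"
    by simp
qed (use p in blast)

definition proj_fun :: "('a::euclidean_space \<Rightarrow> real) \<Rightarrow> 'a \<Rightarrow> 'a set \<Rightarrow> 'a \<Rightarrow> real" where
  "proj_fun f x0 U y = f (x0 + orth_proj U (y - x0))"


subsection \<open>Simplex gradients\<close>

text \<open>
  An ordered set of $m + 1$ points in $n$-space is given by its reference point \<open>x0\<close> together with
  the family \<open>x\<close> of the remaining points, indexed by a finite type \<open>'m\<close> with $m \geq 1$ elements.
\<close>

definition distinct_points :: "real^'n \<Rightarrow> ('m::finite \<Rightarrow> real^'n) \<Rightarrow> bool" where
  "distinct_points x0 x \<longleftrightarrow> inj x \<and> x0 \<notin> range x"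

definition radius :: "real^'n \<Rightarrow> ('m::finite \<Rightarrow> real^'n) \<Rightarrow> real" where
  "radius x0 x = Max (range (\<lambda>i. norm (x i - x0)))"

definition dirs :: "real^'n \<Rightarrow> ('m::finite \<Rightarrow> real^'n) \<Rightarrow> real^'m^'n" where
  "dirs x0 x = (\<chi> k i. (x i - x0) $ k)"

definition full_rank :: "real^'m^'n \<Rightarrow> bool" where
  "full_rank A \<longleftrightarrow> rank A = min CARD('m) CARD('n)"

definition centred_diff :: "(real^'n \<Rightarrow> real) \<Rightarrow> real^'n \<Rightarrow> ('m::finite \<Rightarrow> real^'n) \<Rightarrow> real^'m" where
  "centred_diff f x0 x = (\<chi> i. (f (x0 + (x i - x0)) - f (x0 - (x i - x0))) / 2)"

definition centred_simplex_grad ::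
    "(real^'n \<Rightarrow> real) \<Rightarrow> real^'n \<Rightarrow> ('m::finite \<Rightarrow> real^'n) \<Rightarrow> real^'n" where
  "centred_simplex_grad f x0 x = pinv (transpose (dirs x0 x)) *v centred_diff f x0 x"

definition centred_calculus_grad_log ::
    "real \<Rightarrow> (real^'n \<Rightarrow> real) \<Rightarrow> real^'n \<Rightarrow> ('m::finite \<Rightarrow> real^'n) \<Rightarrow> real^'n" where
  "centred_calculus_grad_log a f x0 x = (1 / (f x0 * ln a)) *\<^sub>R centred_simplex_grad f x0 x"

text \<open>
  Conventions for the logarithm: since \<^prop>\<open>ln (- t) = ln t\<close> for real \<open>t\<close> in the library,
  \<^term>\<open>log a (f y)\<close> is the logarithm of $|f(y)|$ when \<open>f y\<close> is negative; its gradient is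
  $\nabla f / (f \ln a)$ for either sign of \<open>f\<close>. For \<open>a = 1\<close> the function \<^term>\<open>log a\<close> and the
  factor $1 / (f(x^0) \ln a)$ both vanish, because division by zero yields zero.
\<close>

end

theory Submission
  imports Defs
begin

text \<open>
  Write \<open>A = S\<^sup>T\<close>, with pseudoinverse \<open>P\<close>.  The factor \<open>1 / (f x0 * ln a)\<close> is common to both vectors:
  by definition in the first one, by the chain rule for the logarithm in the second.  It remains to
  compare \<open>P \<delta>\<close>, where \<open>\<delta>\<close> is the vector of centred differences, with the gradient at \<open>x0\<close> of
  \<open>f\<close> composed with the orthogonal projection onto \<open>x0 + U\<close>.

  The orthogonal projection onto the column span of \<open>S\<close> is the symmetric matrix \<open>P A\<close>
  (\<open>orth_proj_span_columns\<close>), so the latter gradient is \<open>P (A g)\<close> with \<open>g = grad f x0\<close>.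
  The difference of the two vectors is therefore \<open>P (\<delta> - A g)\<close>, and the whole estimate
  reduces to the entries \<open>\<delta>\<^sub>i - d\<^sub>i \<bullet> g\<close> of the bracket.  Each of them is the error of a centred difference
  along the segment from \<open>x0 - d\<^sub>i\<close> to \<open>x0 + d\<^sub>i\<close>.  The terms of even order cancel there, and integrating
  the Lipschitz bound for the second derivative twice gives the error \<open>L \<parallel>d\<^sub>i\<parallel>\<^sup>3 / 6\<close>
  (\<open>centred_diff_error\<close>).  Each norm \<open>\<parallel>d\<^sub>i\<parallel>\<close> is at most \<open>\<Delta>\<close>, so summing the squares of \<open>m\<close> entries
  contributes \<open>sqrt m\<close>, and one of the three factors \<open>\<Delta>\<close> is absorbed in passing from the
  pseudoinverse of \<open>S\<^sup>T\<close> to that of the rescaled matrix (\<open>pinv_scaleR\<close>).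

  Full rank guarantees that the pseudoinverse exists: one of the two Gram matrices of \<open>A\<close>
  is then invertible.
\<close>

section \<open>Pseudoinverses of matrices of full rank\<close>

lemma is_mp_inverse_transpose:
  assumes "is_mp_inverse A P"
  shows "is_mp_inverse (transpose A) (transpose P)"
proof -
  have "A ** P ** A = A" "P ** A ** P = P"
    "transpose (A ** P) = A ** P" "transpose (P ** A) = P ** A"
    using assms by (simp_all add: is_mp_inverse_def)
  then show ?thesis
    unfolding is_mp_inverse_def
    by (metis matrix_mul_assoc matrix_transpose_mul transpose_transpose)
qed

lemma matrix_mul_scaleR:
  fixes A :: "real^'n^'m" and B :: "real^'k^'n"
  shows "(c *\<^sub>R A) ** B = c *\<^sub>R (A ** B)" and "A ** (c *\<^sub>R B) = c *\<^sub>R (A ** B)"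
  by (simp_all add: matrix_matrix_mult_def vec_eq_iff sum_distrib_left mult_ac)

lemma is_mp_inverse_scaleR:
  assumes "is_mp_inverse A P" and "c \<noteq> 0"
  shows "is_mp_inverse (c *\<^sub>R A) ((1 / c) *\<^sub>R P)"
  using assms by (simp add: is_mp_inverse_def matrix_mul_scaleR transpose_scalar)

lemma pinv_scaleR:
  assumes "is_mp_inverse A P" and "c \<noteq> 0"
  shows "pinv (c *\<^sub>R A) = (1 / c) *\<^sub>R pinv A"
  using pinv_eqI[OF is_mp_inverse_scaleR[OF assms]] pinv_eqI[OF assms(1)] by simp

text \<open>
  If \<open>A\<close> has full column rank, then \<open>A\<^sup>T A\<close> is injective, because \<open>A\<^sup>T A v = 0\<close> forces
  \<open>\<parallel>A v\<parallel>\<^sup>2 = v \<bullet> A\<^sup>T A v = 0\<close>; the pseudoinverse is then \<open>(A\<^sup>T A)\<^sup>-\<^sup>1 A\<^sup>T\<close>.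
\<close>

lemma ex_mp_inverse_full_column_rank:
  fixes A :: "real^'n^'m"
  assumes "rank A = CARD('n)"
  shows "\<exists>P. is_mp_inverse A P"
proof -
  let ?G = "transpose A ** A"
  have "v = 0" if "?G *v v = 0" for v
  proof -
    have "(A *v v) \<bullet> (A *v v) = v \<bullet> (?G *v v)"
      by (metis dot_lmul_matrix matrix_vector_mul_assoc inner_commute transpose_matrix_vector)
    then have "A *v v = 0"
      using that by simp
    then show "v = 0"
      using assms matrix_left_invertible_ker matrix_left_invertible_injective full_rank_injective
      by metis
  qed
  then obtain B where BG: "B ** ?G = mat 1"
    using matrix_left_invertible_ker[of ?G] by blast
  then have GB: "?G ** B = mat 1"
    by (simp add: matrix_left_right_inverse)
  have "transpose B = B ** ?G ** transpose B"
    by (simp only: BG matrix_mul_lid)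
  also have "\<dots> = B ** (?G ** transpose B)"
    by (simp only: matrix_mul_assoc)
  also have "?G ** transpose B = transpose (B ** ?G)"
    by (simp add: matrix_transpose_mul)
  finally have symB: "transpose B = B"
    by (simp add: BG)
  have BGA: "B ** transpose A ** A = mat 1"
    using BG by (simp add: matrix_mul_assoc)
  have "is_mp_inverse A (B ** transpose A)"
    unfolding is_mp_inverse_def
  proof (intro conjI)
    show "A ** (B ** transpose A) ** A = A"
      by (simp add: BGA flip: matrix_mul_assoc) (simp add: BG)
    show "B ** transpose A ** A ** (B ** transpose A) = B ** transpose A"
      by (simp add: BGA)
    show "transpose (A ** (B ** transpose A)) = A ** (B ** transpose A)"
      by (simp add: matrix_transpose_mul symB matrix_mul_assoc)
    show "transpose (B ** transpose A ** A) = B ** transpose A ** A"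
      by (simp add: BGA)
  qed
  then show ?thesis ..
qed

lemma ex_mp_inverse_full_rank:
  fixes A :: "real^'n^'m"
  assumes "full_rank A"
  shows "\<exists>P. is_mp_inverse A P"
proof (cases "rank A = CARD('n)")
  case True
  then show ?thesis
    by (rule ex_mp_inverse_full_column_rank)
next
  case False
  then have "rank (transpose A) = CARD('m)"
    using assms by (simp add: full_rank_def rank_transpose min_def split: if_splits)
  then obtain P where "is_mp_inverse (transpose A) P"
    using ex_mp_inverse_full_column_rank by blast
  then show ?thesis
    using is_mp_inverse_transpose by (metis transpose_transpose)
qed

text \<open>
  \<open>P S\<^sup>T = S P\<^sup>T\<close> has its range in the column span of \<open>S\<close>, and \<open>v - P S\<^sup>T v\<close> is annihilated by \<open>S\<^sup>T\<close>,
  which says that it is orthogonal to all columns of \<open>S\<close>.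
\<close>

lemma orth_proj_span_columns:
  fixes S :: "real^'m^'n"
  assumes P: "is_mp_inverse (transpose S) P"
  shows "orth_proj (span (columns S)) v = (P ** transpose S) *v v"
proof (rule orth_proj_eqI)
  let ?p = "(P ** transpose S) *v v"
  have "P ** transpose S = S ** transpose P"
    using P by (metis is_mp_inverse_def matrix_transpose_mul transpose_transpose)
  then have "?p = S *v (transpose P *v v)"
    by (metis matrix_vector_mul_assoc)
  then show "?p \<in> span (columns S)"
    by (metis matrix_vector_mult_in_columnspace)
  have "transpose S *v ?p = transpose S *v v"
    using P by (metis is_mp_inverse_def matrix_vector_mul_assoc)
  then have zero: "transpose S *v (v - ?p) = 0"
    by (metis matrix_vector_mult_diff_distrib right_minus_eq)
  fix u assume "u \<in> span (columns S)"
  moreover have "orthogonal (v - ?p) c" if c_in: "c \<in> columns S" for c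
  proof -
    obtain i where c: "c = column i S"
      using c_in by (auto simp: columns_def)
    have "c \<bullet> (v - ?p) = (transpose S *v (v - ?p)) $ i"
      unfolding matrix_vector_mul_component c by (simp add: row_def column_def transpose_def)
    then show ?thesis
      by (metis zero zero_index inner_commute orthogonal_def)
  qed
  ultimately show "orthogonal (v - ?p) u"
    by (rule orthogonal_to_span)
qed simp

lemma norm_matrix_vector_mult_le_opnorm: "norm (A *v v) \<le> opnorm A * norm v"
  unfolding opnorm_def by (rule onorm) simp

section \<open>Gradient and Hessian\<close>

lemma GDERIV_grad:
  fixes f :: "'a::euclidean_space \<Rightarrow> real"
  assumes "f differentiable (at x)"
  shows "GDERIV f x :> grad f x"
proof -
  let ?D = "frechet_derivative f (at x)"
  have D: "(f has_derivative ?D) (at x)"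
    using assms by (simp add: frechet_derivative_works)
  have "?D h = h \<bullet> (\<Sum>b\<in>Basis. ?D b *\<^sub>R b)" for h
  proof -
    have "?D h = ?D (\<Sum>b\<in>Basis. (h \<bullet> b) *\<^sub>R b)"
      by (simp only: euclidean_representation)
    also have "\<dots> = (\<Sum>b\<in>Basis. (h \<bullet> b) * ?D b)"
      using has_derivative_linear[OF D] by (simp add: linear_sum linear_cmul)
    finally show ?thesis
      by (simp add: inner_sum_right mult.commute)
  qed
  then have "GDERIV f x :> (\<Sum>b\<in>Basis. ?D b *\<^sub>R b)"
    using D unfolding gderiv_def by (metis (no_types, lifting) ext)
  then show ?thesis
    using grad_eqI by metis
qed

lemma frechet_derivative_eq_inner_grad:
  fixes f :: "'a::euclidean_space \<Rightarrow> real"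
  assumes "f differentiable (at x)"
  shows "frechet_derivative f (at x) = (\<lambda>v. v \<bullet> grad f x)"
  using GDERIV_grad[OF assms] unfolding gderiv_def by (metis frechet_derivative_at)

lemma grad_differentiable:
  fixes f :: "'a::euclidean_space \<Rightarrow> real"
  assumes f: "C_k_on (Suc (Suc k)) f T" and T: "open T" "x \<in> T"
  shows "grad f differentiable (at x)"
proof (subst differentiable_componentwise_within, rule ballI)
  fix b :: 'a assume "b \<in> Basis"
  have "(\<lambda>y. frechet_derivative f (at y) b) differentiable (at x)"
    using f T by simp
  then obtain D where "((\<lambda>y. frechet_derivative f (at y) b) has_derivative D) (at x)"
    by (auto simp: differentiable_def)
  then have "((\<lambda>y. grad f y \<bullet> b) has_derivative D) (at x)"
  proof (rule has_derivative_transform_within_open[OF _ T])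
    show "frechet_derivative f (at y) b = grad f y \<bullet> b" if "y \<in> T" for y
      using f that by (simp add: frechet_derivative_eq_inner_grad inner_commute)
  qed
  then show "(\<lambda>y. grad f y \<bullet> b) differentiable (at x)"
    by (auto simp: differentiable_def)
qed

lemma has_real_derivative_along_line:
  fixes f :: "'a::euclidean_space \<Rightarrow> real"
  assumes "f differentiable (at (p + s *\<^sub>R d))"
  shows "((\<lambda>s. f (p + s *\<^sub>R d)) has_real_derivative d \<bullet> grad f (p + s *\<^sub>R d)) (at s)"
proof -
  have line: "((\<lambda>s. p + s *\<^sub>R d) has_derivative (\<lambda>h. h *\<^sub>R d)) (at s)"
    by (auto intro!: derivative_eq_intros)
  have "((\<lambda>s. f (p + s *\<^sub>R d)) has_derivative (\<lambda>h. (h *\<^sub>R d) \<bullet> grad f (p + s *\<^sub>R d))) (at s)"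
    using has_derivative_compose[OF line] GDERIV_grad[OF assms] unfolding gderiv_def .
  then show ?thesis
    by (simp add: has_field_derivative_def mult_commute_abs)
qed

lemma has_real_derivative_grad_along_line:
  fixes f :: "real^'n \<Rightarrow> real"
  assumes "grad f differentiable (at (p + s *\<^sub>R d))"
  shows "((\<lambda>s. d \<bullet> grad f (p + s *\<^sub>R d)) has_real_derivative
           d \<bullet> (hessian f (p + s *\<^sub>R d) *v d)) (at s)"
proof -
  have line: "((\<lambda>s. p + s *\<^sub>R d) has_derivative (\<lambda>h. h *\<^sub>R d)) (at s)"
    by (auto intro!: derivative_eq_intros)
  have "(grad f has_derivative (\<lambda>h. hessian f (p + s *\<^sub>R d) *v h)) (at (p + s *\<^sub>R d))"
    using assms by (simp add: hessian_def jacobian_works)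
  then have "((\<lambda>s. d \<bullet> grad f (p + s *\<^sub>R d)) has_derivative
      (\<lambda>h. d \<bullet> (hessian f (p + s *\<^sub>R d) *v (h *\<^sub>R d)))) (at s)"
    by (intro has_derivative_inner_right has_derivative_compose[OF line])
  then show ?thesis
    by (simp add: has_field_derivative_def matrix_vector_mult_scaleR mult_commute_abs)
qed

section \<open>The error of centred differences\<close>

lemma abs_le_power_if_abs_deriv_le_power:
  fixes \<phi> \<phi>' :: "real \<Rightarrow> real"
  assumes t: "0 \<le> t" and "\<phi> 0 = 0"
    and deriv: "\<And>s. 0 \<le> s \<Longrightarrow> s \<le> t \<Longrightarrow> (\<phi> has_real_derivative \<phi>' s) (at s)"
    and bound: "\<And>s. 0 \<le> s \<Longrightarrow> s \<le> t \<Longrightarrow> \<bar>\<phi>' s\<bar> \<le> c * s ^ n"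
  shows "\<bar>\<phi> t\<bar> \<le> c / real (Suc n) * t ^ Suc n"
proof -
  let ?q = "\<lambda>s. c / real (Suc n) * s ^ Suc n"
  have q: "(?q has_real_derivative c * s ^ n) (at s)" for s
    by (rule derivative_eq_intros refl | simp)+
  have "?q 0 - \<phi> 0 \<le> ?q t - \<phi> t"
    using t
  proof (rule DERIV_nonneg_imp_nondecreasing)
    fix s assume s: "0 \<le> s" "s \<le> t"
    show "\<exists>y. ((\<lambda>s. ?q s - \<phi> s) has_real_derivative y) (at s) \<and> 0 \<le> y"
      using DERIV_diff[OF q deriv[OF s]] bound[OF s] by (intro exI conjI) auto
  qed
  moreover have "?q 0 + \<phi> 0 \<le> ?q t + \<phi> t"
    using t
  proof (rule DERIV_nonneg_imp_nondecreasing)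
    fix s assume s: "0 \<le> s" "s \<le> t"
    show "\<exists>y. ((\<lambda>s. ?q s + \<phi> s) has_real_derivative y) (at s) \<and> 0 \<le> y"
      using DERIV_add[OF q deriv[OF s]] bound[OF s] by (intro exI conjI) auto
  qed
  ultimately show ?thesis
    using \<open>\<phi> 0 = 0\<close> by (simp del: of_nat_Suc)
qed

text \<open>
  The odd function \<open>\<phi> s = h s - h (- s) - 2 s h' 0\<close> and its first derivative both vanish
  at 0, and its second derivative \<open>h'' s - h'' (- s)\<close> is at most \<open>2 K s\<close> in absolute value for \<open>s \<ge> 0\<close>.
  Integrating twice from 0 gives \<open>\<bar>\<phi> 1\<bar> \<le> K / 3\<close>, and \<open>\<phi> 1\<close> is twice the error.
\<close>

lemma centred_difference_quotient_error:
  fixes h h' h'' :: "real \<Rightarrow> real"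
  assumes h: "\<And>s. \<bar>s\<bar> \<le> 1 \<Longrightarrow> (h has_real_derivative h' s) (at s)"
    and h': "\<And>s. \<bar>s\<bar> \<le> 1 \<Longrightarrow> (h' has_real_derivative h'' s) (at s)"
    and bound: "\<And>s. 0 \<le> s \<Longrightarrow> s \<le> 1 \<Longrightarrow> \<bar>h'' s - h'' (- s)\<bar> \<le> K * (2 * s)"
  shows "\<bar>(h 1 - h (- 1)) / 2 - h' 0\<bar> \<le> K / 6"
proof -
  have reflect: "((\<lambda>s. g (- s)) has_real_derivative - D) (at s)"
    if "(g has_real_derivative D) (at (- s))" for g :: "real \<Rightarrow> real" and D s
    using that by (simp add: DERIV_mirror)
  have slope: "\<bar>h' s + h' (- s) - 2 * h' 0\<bar> \<le> K * s ^ 2" if s: "0 \<le> s" "s \<le> 1" for s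
  proof -
    have "\<bar>h' s + h' (- s) - 2 * h' 0\<bar> \<le> 2 * K / real (Suc 1) * s ^ Suc 1"
    proof (rule abs_le_power_if_abs_deriv_le_power[where \<phi>' = "\<lambda>s. h'' s - h'' (- s)"])
      fix r assume r: "0 \<le> r" "r \<le> s"
      show "((\<lambda>s. h' s + h' (- s) - 2 * h' 0) has_real_derivative h'' r - h'' (- r)) (at r)"
        using r s by (auto intro!: derivative_eq_intros h' reflect)
      show "\<bar>h'' r - h'' (- r)\<bar> \<le> 2 * K * r ^ 1"
        using bound[of r] r s by (simp add: mult_ac)
    qed (use s in auto)
    then show ?thesis
      by (simp add: power2_eq_square)
  qed
  have "\<bar>h 1 - h (- 1) - 2 * h' 0 * 1\<bar> \<le> K / real (Suc 2) * 1 ^ Suc 2"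
  proof (rule abs_le_power_if_abs_deriv_le_power
      [where \<phi> = "\<lambda>s. h s - h (- s) - 2 * h' 0 * s" and \<phi>' = "\<lambda>s. h' s + h' (- s) - 2 * h' 0"])
    fix r :: real assume r: "0 \<le> r" "r \<le> 1"
    show "((\<lambda>s. h s - h (- s) - 2 * h' 0 * s) has_real_derivative
        h' r + h' (- r) - 2 * h' 0) (at r)"
      using r by (auto intro!: derivative_eq_intros h reflect[of h "h' (- r)"])
    show "\<bar>h' r + h' (- r) - 2 * h' 0\<bar> \<le> K * r ^ 2"
      using slope r .
  qed auto
  then have "\<bar>h 1 - h (- 1) - 2 * h' 0\<bar> \<le> K / 3"
    by simp
  moreover have "(h 1 - h (- 1)) / 2 - h' 0 = (h 1 - h (- 1) - 2 * h' 0) / 2"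
    by (simp add: diff_divide_distrib)
  ultimately show ?thesis
    by (simp only: abs_divide) simp
qed

lemma centred_diff_error:
  fixes f :: "real^'n \<Rightarrow> real"
  assumes f: "C_k_on 3 f (ball p r)"
    and lip: "\<forall>y\<in>ball p r. \<forall>z\<in>ball p r. opnorm (hessian f y - hessian f z) \<le> L * norm (y - z)"
    and d: "norm d < r"
  shows "\<bar>(f (p + d) - f (p - d)) / 2 - d \<bullet> grad f p\<bar> \<le> L * norm d ^ 3 / 6"
proof -
  have in_ball: "p + s *\<^sub>R d \<in> ball p r" if "\<bar>s\<bar> \<le> 1" for s
  proof -
    have "\<bar>s\<bar> * norm d \<le> 1 * norm d"
      using that by (intro mult_right_mono) auto
    then show ?thesis
      using d by (simp add: dist_norm)
  qed
  let ?H = "\<lambda>s. hessian f (p + s *\<^sub>R d)"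
  have "\<bar>(f (p + 1 *\<^sub>R d) - f (p + (- 1) *\<^sub>R d)) / 2 - d \<bullet> grad f (p + 0 *\<^sub>R d)\<bar>
      \<le> L * norm d ^ 3 / 6"
  proof (rule centred_difference_quotient_error[where h'' = "\<lambda>s. d \<bullet> (?H s *v d)"])
    fix s :: real assume "\<bar>s\<bar> \<le> 1"
    then have s: "p + s *\<^sub>R d \<in> ball p r"
      by (rule in_ball)
    show "((\<lambda>s. f (p + s *\<^sub>R d)) has_real_derivative d \<bullet> grad f (p + s *\<^sub>R d)) (at s)"
      using f s by (intro has_real_derivative_along_line) (simp add: numeral_3_eq_3)
    show "((\<lambda>s. d \<bullet> grad f (p + s *\<^sub>R d)) has_real_derivative d \<bullet> (?H s *v d)) (at s)"
      using grad_differentiable[OF f[unfolded numeral_3_eq_3] open_ball s]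
      by (rule has_real_derivative_grad_along_line)
  next
    fix s :: real assume s: "0 \<le> s" "s \<le> 1"
    have "\<bar>d \<bullet> (?H s *v d) - d \<bullet> (?H (- s) *v d)\<bar> = \<bar>d \<bullet> ((?H s - ?H (- s)) *v d)\<bar>"
      by (simp add: matrix_vector_mult_diff_rdistrib inner_diff_right)
    also have "\<dots> \<le> norm d * norm ((?H s - ?H (- s)) *v d)"
      by (rule Cauchy_Schwarz_ineq2)
    also have "\<dots> \<le> norm d * (opnorm (?H s - ?H (- s)) * norm d)"
      by (intro mult_left_mono norm_matrix_vector_mult_le_opnorm) simp
    also have "\<dots> \<le> norm d * (L * norm ((p + s *\<^sub>R d) - (p + (- s) *\<^sub>R d)) * norm d)"
      using s by (intro mult_left_mono mult_right_mono lip[rule_format] in_ball) auto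
    also have "(p + s *\<^sub>R d) - (p + (- s) *\<^sub>R d) = (2 * s) *\<^sub>R d"
      by (simp flip: scaleR_left_distrib)
    also have "norm d * (L * norm ((2 * s) *\<^sub>R d) * norm d) = L * norm d ^ 3 * (2 * s)"
      using s by (simp add: power3_eq_cube)
    finally show "\<bar>d \<bullet> (?H s *v d) - d \<bullet> (?H (- s) *v d)\<bar> \<le> L * norm d ^ 3 * (2 * s)" .
  qed
  then show ?thesis
    by simp
qed

lemma norm_le_sqrt_card:
  fixes v :: "real^'m"
  assumes "\<And>i. \<bar>v $ i\<bar> \<le> c"
  shows "norm v \<le> sqrt (real CARD('m)) * c"
proof -
  have "0 \<le> c"
    using assms[of undefined] by linarith
  have "norm v \<le> norm (\<chi> i::'m. c)"
    using assms \<open>0 \<le> c\<close> by (intro norm_le_componentwise_cart) simp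
  also have "\<dots> = sqrt (real CARD('m)) * c"
    using \<open>0 \<le> c\<close> by (simp add: norm_vec_def L2_set_constant)
  finally show ?thesis .
qed

section \<open>The gradient of the projected function and its logarithm\<close>

text \<open>
  The logarithm of the library is even, so one formula covers both signs of \<open>f\<close>.  For \<open>b = 1\<close> both
  sides are 0.
\<close>

lemma DERIV_log_nonzero:
  fixes t :: real
  assumes "t \<noteq> 0"
  shows "(log b has_real_derivative 1 / (t * ln b)) (at t)"
proof (cases "0 < t")
  case True
  then show ?thesis
    using DERIV_log[of t b] by (simp add: mult.commute)
next
  case False
  then have "0 < - t"
    using assms by simp
  then have "((\<lambda>s. log b (- s)) has_real_derivative - (1 / (ln b * - t))) (at t)"
    using DERIV_log DERIV_mirror by blast
  moreover have "log b (- s) = log b s" for s :: real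
    by (simp add: log_def ln_minus)
  ultimately show ?thesis
    by (simp add: mult.commute)
qed

lemma GDERIV_proj_fun:
  fixes f :: "real^'n \<Rightarrow> real" and S :: "real^'m^'n"
  assumes f: "f differentiable (at p)" and P: "is_mp_inverse (transpose S) P"
  shows "GDERIV (proj_fun f p (span (columns S))) p :> P *v (transpose S *v grad f p)"
proof -
  let ?Q = "P ** transpose S"
  have fun_eq: "proj_fun f p (span (columns S)) = (\<lambda>y. f (p + ?Q *v (y - p)))"
    using orth_proj_span_columns[OF P] by (simp add: proj_fun_def fun_eq_iff)
  have "((\<lambda>y. p + ?Q *v (y - p)) has_derivative (\<lambda>h. ?Q *v h)) (at p)"
    by (auto intro!: derivative_eq_intros bounded_linear.has_derivative[OF matrix_vector_mul_bounded_linear])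
  from has_derivative_compose[OF this] GDERIV_grad[OF f]
  have "((\<lambda>y. f (p + ?Q *v (y - p))) has_derivative (\<lambda>h. (?Q *v h) \<bullet> grad f p)) (at p)"
    by (simp add: gderiv_def)
  moreover have "(?Q *v h) \<bullet> grad f p = h \<bullet> (?Q *v grad f p)" for h
    using P unfolding is_mp_inverse_def
    by (metis dot_lmul_matrix transpose_matrix_vector)
  ultimately show ?thesis
    by (simp add: gderiv_def fun_eq matrix_vector_mul_assoc del: transpose_matrix_vector)
qed

section \<open>The error bound\<close>

theorem proposition5p14:
  fixes f :: "real^'n \<Rightarrow> real" and x0 :: "real^'n" and x :: "'m::finite \<Rightarrow> real^'n"
    and \<Delta>bar \<Delta> L a :: real
    and S Shat :: "real^'m^'n" and U :: "(real^'n) set"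
  assumes C3: "C_k_on 3 f (ball x0 \<Delta>bar)"
    and nz: "f x0 \<noteq> 0"
    and lip: "\<forall>y\<in>ball x0 \<Delta>bar. \<forall>z\<in>ball x0 \<Delta>bar.
                opnorm (hessian f y - hessian f z) \<le> L * norm (y - z)"
    and distinct: "distinct_points x0 x"
    and \<Delta>_def: "\<Delta> = radius x0 x"
    and \<Delta>_less: "\<Delta> < \<Delta>bar"
    and S_def: "S = dirs x0 x"
    and full: "full_rank S"
    and U_def: "U = span (columns S)"
    and Shat_def: "Shat = (1 / \<Delta>) *\<^sub>R S"
    and a_pos: "a > 0"
  shows "norm (centred_calculus_grad_log a f x0 x - grad (\<lambda>y. log a (proj_fun f x0 U y)) x0)
           \<le> \<bar>1 / (f x0 * ln a)\<bar> * (L * sqrt (real CARD('m)) / 6)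
              * opnorm (pinv (transpose Shat)) * \<Delta>\<^sup>2"
proof -
  define d where "d i = x i - x0" for i
  have d_pos: "0 < norm (d i)" for i
    using distinct by (auto simp: distinct_points_def d_def)
  have d_le: "norm (d i) \<le> \<Delta>" for i
    unfolding \<Delta>_def radius_def d_def by (rule Max_ge) auto
  have \<Delta>_pos: "0 < \<Delta>"
    using d_pos d_le less_le_trans by blast
  \<comment> \<open>The Lipschitz condition bounds \<open>L\<close> from below once it is applied to two distinct points.\<close>
  have "0 \<le> L"
  proof -
    fix i :: 'm
    have "0 \<le> opnorm (hessian f (x i) - hessian f x0)"
      unfolding opnorm_def by (rule onorm_pos_le) simp
    also have "\<dots> \<le> L * norm (d i)"
      unfolding d_def
    proof (rule lip[rule_format])
      show "x i \<in> ball x0 \<Delta>bar"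
        using d_le[of i] \<Delta>_less by (simp add: d_def dist_norm norm_minus_commute)
      show "x0 \<in> ball x0 \<Delta>bar"
        using \<Delta>_pos \<Delta>_less by simp
    qed
    finally show ?thesis
      using d_pos[of i] by (simp add: zero_le_mult_iff)
  qed
  have f_diff: "f differentiable (at x0)"
    using C3 \<Delta>_pos \<Delta>_less by (simp add: numeral_3_eq_3)
  obtain P0 where "is_mp_inverse S P0"
    using ex_mp_inverse_full_rank[OF full] by blast
  then have mp0: "is_mp_inverse (transpose S) (transpose P0)"
    by (rule is_mp_inverse_transpose)
  define P where "P = pinv (transpose S)"
  have mp: "is_mp_inverse (transpose S) P"
    using mp0 pinv_eqI[OF mp0] by (simp add: P_def)
  have opnorm_P: "opnorm P = opnorm (pinv (transpose Shat)) / \<Delta>"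
  proof -
    have "pinv (transpose Shat) = \<Delta> *\<^sub>R P"
      using pinv_scaleR[OF mp, of "1 / \<Delta>"] \<Delta>_pos by (simp add: Shat_def transpose_scalar P_def)
    then have "opnorm (pinv (transpose Shat)) = onorm (\<lambda>v. \<Delta> *\<^sub>R (P *v v))"
      by (simp add: opnorm_def scaleR_matrix_vector_assoc)
    also have "\<dots> = \<Delta> * opnorm P"
      using \<Delta>_pos by (simp add: onorm_scaleR opnorm_def)
    finally show ?thesis
      using \<Delta>_pos by simp
  qed
  let ?c = "1 / (f x0 * ln a)" and ?g = "grad f x0" and ?\<delta> = "centred_diff f x0 x"
  have "proj_fun f x0 U x0 = f x0"
    by (simp add: proj_fun_def U_def orth_proj_span_columns[OF mp])
  then have "GDERIV (\<lambda>y. log a (proj_fun f x0 U y)) x0 :> ?c *\<^sub>R (P *v (transpose S *v ?g))"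
    unfolding U_def
    by (intro GDERIV_DERIV_compose GDERIV_proj_fun f_diff mp) (simp add: DERIV_log_nonzero nz)
  from grad_eqI[OF this]
  have "centred_calculus_grad_log a f x0 x - grad (\<lambda>y. log a (proj_fun f x0 U y)) x0
      = ?c *\<^sub>R (P *v (?\<delta> - transpose S *v ?g))"
    by (simp add: centred_calculus_grad_log_def centred_simplex_grad_def P_def S_def
        scaleR_diff_right matrix_vector_mult_diff_distrib del: transpose_matrix_vector)
  then have "norm (centred_calculus_grad_log a f x0 x - grad (\<lambda>y. log a (proj_fun f x0 U y)) x0)
      = \<bar>?c\<bar> * norm (P *v (?\<delta> - transpose S *v ?g))"
    by (simp only: norm_scaleR)
  also have "\<dots> \<le> \<bar>?c\<bar> * (opnorm P * (sqrt (real CARD('m)) * (L * \<Delta> ^ 3 / 6)))"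
  proof (intro mult_left_mono order_trans[OF norm_matrix_vector_mult_le_opnorm] norm_le_sqrt_card)
    fix i
    have "(transpose S *v ?g) $ i = d i \<bullet> ?g"
      unfolding matrix_vector_mul_component
      by (simp add: S_def dirs_def d_def row_def transpose_def inner_vec_def)
    then have "\<bar>(?\<delta> - transpose S *v ?g) $ i\<bar>
        = \<bar>(f (x0 + d i) - f (x0 - d i)) / 2 - d i \<bullet> ?g\<bar>"
      by (simp add: centred_diff_def d_def del: transpose_matrix_vector)
    also have "\<dots> \<le> L * norm (d i) ^ 3 / 6"
      using d_le[of i] \<Delta>_less by (intro centred_diff_error[OF C3 lip]) simp
    also have "\<dots> \<le> L * \<Delta> ^ 3 / 6"
      using d_le \<open>0 \<le> L\<close> by (intro divide_right_mono mult_left_mono power_mono) auto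
    finally show "\<bar>(?\<delta> - transpose S *v ?g) $ i\<bar> \<le> L * \<Delta> ^ 3 / 6" .
  next
    show "0 \<le> opnorm P"
      unfolding opnorm_def by (rule onorm_pos_le) simp
  qed simp
  also have "\<dots> = \<bar>?c\<bar> * (L * sqrt (real CARD('m)) / 6) * opnorm (pinv (transpose Shat)) * \<Delta>\<^sup>2"
    using \<Delta>_pos by (simp add: opnorm_P power2_eq_square power3_eq_cube)
  finally show ?thesis .
qed

end
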